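(* Let $\delta$ be a diagonal function, and let $C$ be a copula with diagonal section $\delta$, i.e. $C(x,x)=\delta(x)$ for all $x\in[0,1]$. Then $C$ is undominated in the family of copulas with diagonal section $\delta$ if and only if $C=C_\psi$ for some $\psi\in\mathcal{E}$.
   Context: "Increasing" means non-decreasing; $a\wedge b=\min\{a,b\}$. A bivariate copula is a function $C:[0,1]^2\to[0,1]$ with $C(x,0)=C(0,x)=0$, $C(x,1)=C(1,x)=x$ and $C(x_2,y_2)-C(x_1,y_2)-C(x_2,y_1)+C(x_1,y_1)\ge0$ whenever $x_1\le x_2$, $y_1\le y_2$. A diagonal function is a function $\delta:[0,1]\to[0,1]$ that is increasing, satisfies $\delta(1)=1$, $\delta(t)\le t$ for all $t$, and $|\delta(t')-\delta(t)|\le 2|t'-t|$ for all $t,t'$. A copula $C$ with diagonal section $\delta$ is undominated if there is no copula $C'\neq C$ with the same diagonal section such that $C\le C'$ pointwise. The set $\mathcal{E}$ of eligible functions consists of all $\psi:[0,1]\to\mathbb{R}$ with $\psi(0)=0$ such that the four functions $\psi(x)$, $x-\psi(x)$, $x-\delta(x)+\psi(x)$, $\delta(x)-\psi(x)$ are all increasing on $[0,1]$. For such $\psi$, $$C_\psi(x,y)=\bigl[\psi(x)\wedge(y-\delta(y)+\psi(y))\bigr]+\bigl[(x-\psi(x))\wedge(\delta(y)-\psi(y))\bigr].$$ *)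

theory Defs
  imports "HOL-Analysis.Analysis"
begin

text \<open>
  Functions on the unit interval or on the unit square are represented by total functions on the
  reals. Every condition below, including equality and the pointwise order of copulas, refers only
  to arguments in the unit interval; values elsewhere are irrelevant.
\<close>

definition copula :: "(real \<Rightarrow> real \<Rightarrow> real) \<Rightarrow> bool" where
  "copula C \<longleftrightarrow>
     (\<forall>x\<in>{0..1}. \<forall>y\<in>{0..1}. C x y \<in> {0..1}) \<and>
     (\<forall>x\<in>{0..1}. C x 0 = 0 \<and> C 0 x = 0 \<and> C x 1 = x \<and> C 1 x = x) \<and>
     (\<forall>x1\<in>{0..1}. \<forall>x2\<in>{0..1}. \<forall>y1\<in>{0..1}. \<forall>y2\<in>{0..1}.
        x1 \<le> x2 \<longrightarrow> y1 \<le> y2 \<longrightarrow> C x2 y2 - C x1 y2 - C x2 y1 + C x1 y1 \<ge> 0)"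

definition diagonal_function :: "(real \<Rightarrow> real) \<Rightarrow> bool" where
  "diagonal_function \<delta> \<longleftrightarrow>
     (\<forall>t\<in>{0..1}. \<delta> t \<in> {0..1}) \<and>
     mono_on {0..1} \<delta> \<and>
     \<delta> 1 = 1 \<and>
     (\<forall>t\<in>{0..1}. \<delta> t \<le> t) \<and>
     (\<forall>t\<in>{0..1}. \<forall>t'\<in>{0..1}. \<bar>\<delta> t' - \<delta> t\<bar> \<le> 2 * \<bar>t' - t\<bar>)"

definition has_diagonal_section :: "(real \<Rightarrow> real \<Rightarrow> real) \<Rightarrow> (real \<Rightarrow> real) \<Rightarrow> bool" where
  "has_diagonal_section C \<delta> \<longleftrightarrow> (\<forall>x\<in>{0..1}. C x x = \<delta> x)"

definition eq_on_square :: "(real \<Rightarrow> real \<Rightarrow> real) \<Rightarrow> (real \<Rightarrow> real \<Rightarrow> real) \<Rightarrow> bool" where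
  "eq_on_square C D \<longleftrightarrow> (\<forall>x\<in>{0..1}. \<forall>y\<in>{0..1}. C x y = D x y)"

definition le_on_square :: "(real \<Rightarrow> real \<Rightarrow> real) \<Rightarrow> (real \<Rightarrow> real \<Rightarrow> real) \<Rightarrow> bool" where
  "le_on_square C D \<longleftrightarrow> (\<forall>x\<in>{0..1}. \<forall>y\<in>{0..1}. C x y \<le> D x y)"

definition undominated :: "(real \<Rightarrow> real) \<Rightarrow> (real \<Rightarrow> real \<Rightarrow> real) \<Rightarrow> bool" where
  "undominated \<delta> C \<longleftrightarrow>
     \<not> (\<exists>C'. copula C' \<and> has_diagonal_section C' \<delta> \<and> \<not> eq_on_square C' C \<and> le_on_square C C')"

definition eligible :: "(real \<Rightarrow> real) \<Rightarrow> (real \<Rightarrow> real) set" where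
  "eligible \<delta> = {\<psi>. \<psi> 0 = 0 \<and>
     mono_on {0..1} \<psi> \<and>
     mono_on {0..1} (\<lambda>x. x - \<psi> x) \<and>
     mono_on {0..1} (\<lambda>x. x - \<delta> x + \<psi> x) \<and>
     mono_on {0..1} (\<lambda>x. \<delta> x - \<psi> x)}"

definition C_psi :: "(real \<Rightarrow> real) \<Rightarrow> (real \<Rightarrow> real) \<Rightarrow> real \<Rightarrow> real \<Rightarrow> real" where
  "C_psi \<delta> \<psi> x y = min (\<psi> x) (y - \<delta> y + \<psi> y) + min (x - \<psi> x) (\<delta> y - \<psi> y)"

end

theory Submission
  imports Defs
begin

text \<open>
  Every copula \<open>C\<close> with diagonal \<open>\<delta>\<close> lies below some \<open>C\<^sub>\<psi>\<close>. If \<open>(U, V)\<close> has distribution \<open>C\<close>,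
  one takes \<open>\<psi> x = P(U \<le> x, V < U)\<close>; both parts of the mass, below and above the diagonal, are
  then replaced by comonotone couplings, which keeps the diagonal section and, by the
  Frechet-Hoeffding bound, increases the copula. In terms of increments over \<open>a \<le> b\<close>, what is
  required of \<open>\<psi>\<close> is \<open>C b a - \<delta> a \<le> \<psi> b - \<psi> a \<le> \<delta> b - C a b\<close>. The lower bound is a subadditive
  and the upper bound a superadditive interval function, so an additive one fits in between.

  Conversely, if \<open>C\<^sub>\<psi> \<le> C' \<le> C\<^sub>\<phi>\<close>, then \<open>\<psi> - \<phi>\<close> is locally constant on \<open>{t. \<delta> t < t}\<close>, while any
  copula is forced to be \<open>min x y\<close> as soon as \<open>\<delta>\<close> has a fixed point between \<open>x\<close> and \<open>y\<close>.
\<close>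

section \<open>Additive functions between interval functions\<close>

definition superadditive_on :: "real set \<Rightarrow> (real \<Rightarrow> real \<Rightarrow> real) \<Rightarrow> bool" where
  "superadditive_on S r \<longleftrightarrow>
     (\<forall>a\<in>S. \<forall>b\<in>S. \<forall>c\<in>S. a \<le> b \<longrightarrow> b \<le> c \<longrightarrow> r a b + r b c \<le> r a c)"

lemma superadditive_onD:
  "superadditive_on S r \<Longrightarrow> a \<in> S \<Longrightarrow> b \<in> S \<Longrightarrow> c \<in> S \<Longrightarrow> a \<le> b \<Longrightarrow> b \<le> c
    \<Longrightarrow> r a b + r b c \<le> r a c"
  by (auto simp: superadditive_on_def)

text \<open>A sandwich theorem in the style of Hahn-Banach: the pointwise infimum of all
  superadditive majorants of \<open>p\<close> is again one, hence the least one, and leastness makes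
  it subadditive as well.\<close>

lemma additive_between:
  fixes p q :: "real \<Rightarrow> real \<Rightarrow> real"
  assumes sub: "\<And>a b c. a \<in> S \<Longrightarrow> b \<in> S \<Longrightarrow> c \<in> S \<Longrightarrow> a \<le> b \<Longrightarrow> b \<le> c \<Longrightarrow> p a c \<le> p a b + p b c"
    and super: "superadditive_on S q"
    and le: "\<And>a b. a \<in> S \<Longrightarrow> b \<in> S \<Longrightarrow> a \<le> b \<Longrightarrow> p a b \<le> q a b"
    and diag: "\<And>a. a \<in> S \<Longrightarrow> q a a = 0"
  shows "\<exists>P. (\<forall>a\<in>S. \<forall>b\<in>S. a \<le> b \<longrightarrow> p a b \<le> P a b \<and> P a b \<le> q a b) \<and>
    (\<forall>a\<in>S. \<forall>b\<in>S. \<forall>c\<in>S. a \<le> b \<longrightarrow> b \<le> c \<longrightarrow> P a c = P a b + P b c)"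
proof -
  define R where "R = {r. superadditive_on S r \<and> (\<forall>a\<in>S. \<forall>b\<in>S. a \<le> b \<longrightarrow> p a b \<le> r a b)}"
  define P where "P a b = (INF r\<in>R. r a b)" for a b
  have qR: "q \<in> R"
    using super le by (auto simp: R_def)
  have PR: "P a b \<le> r a b" if "a \<in> S" "b \<in> S" "a \<le> b" "r \<in> R" for a b r
    unfolding P_def
  proof (rule cINF_lower)
    show "bdd_below ((\<lambda>r. r a b) ` R)"
      using that by (auto simp: R_def intro!: bdd_belowI2[where m = "p a b"])
  qed (fact that)
  have pP: "p a b \<le> P a b" if "a \<in> S" "b \<in> S" "a \<le> b" for a b
    unfolding P_def
  proof (rule cINF_greatest)
    show "p a b \<le> r a b" if "r \<in> R" for r
      using that \<open>a \<in> S\<close> \<open>b \<in> S\<close> \<open>a \<le> b\<close> by (simp add: R_def)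
  qed (use qR in auto)
  have superP: "superadditive_on S P"
    unfolding superadditive_on_def
  proof (intro ballI impI)
    fix a b c assume S: "a \<in> S" "b \<in> S" "c \<in> S" and ord: "a \<le> b" "b \<le> c"
    show "P a b + P b c \<le> P a c"
      unfolding P_def[of a c]
    proof (rule cINF_greatest)
      fix r assume r: "r \<in> R"
      then have "r a b + r b c \<le> r a c"
        using S ord by (auto simp: R_def dest: superadditive_onD)
      with PR[OF _ _ _ r, of a b] PR[OF _ _ _ r, of b c] S ord show "P a b + P b c \<le> r a c"
        by linarith
    qed (use qR in auto)
  qed
  have subP: "P a c \<le> P a b + P b c" if S: "a \<in> S" "b \<in> S" "c \<in> S" and ord: "a \<le> b" "b \<le> c" for a b c
  proof -
    \<comment> \<open>By minimality of \<open>P\<close> in \<open>R\<close>: splitting \<open>P\<close> at the point \<open>b\<close> does not lead out of \<open>R\<close>.\<close>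
    define r where "r x y = (if x \<le> b \<and> b \<le> y then P x b + P b y else P x y)" for x y
    \<comment> \<open>This handles two intervals that meet exactly at \<open>b\<close>: both are
      then split, and \<open>P b b\<close> is counted twice.\<close>
    have Pb: "P b b \<le> 0"
      using PR[OF S(2) S(2) _ qR] diag[OF S(2)] by simp
    have "superadditive_on S r"
      unfolding superadditive_on_def
    proof (intro ballI impI)
      fix x y z assume "x \<in> S" "y \<in> S" "z \<in> S" "x \<le> y" "y \<le> z"
      then show "r x y + r y z \<le> r x z"
        using superadditive_onD[OF superP, of x y z] superadditive_onD[OF superP, of x y b]
          superadditive_onD[OF superP, of b y z] S Pb
        by (auto simp: r_def not_le)
    qed
    moreover have "p x y \<le> r x y" if "x \<in> S" "y \<in> S" "x \<le> y" for x y
      using that sub[of x b y] pP[of x b] pP[of b y] pP[of x y] S by (auto simp: r_def)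
    ultimately have "r \<in> R"
      by (auto simp: R_def)
    from PR[OF _ _ _ this, of a c] show ?thesis
      using S ord by (auto simp: r_def)
  qed
  have "P a c = P a b + P b c" if "a \<in> S" "b \<in> S" "c \<in> S" "a \<le> b" "b \<le> c" for a b c
    using subP[OF that] superadditive_onD[OF superP that] by simp
  with pP PR[OF _ _ _ qR] show ?thesis
    by blast
qed

section \<open>Copulas\<close>

lemma copula_rectangle:
  assumes "copula C" "x1 \<in> {0..1}" "x2 \<in> {0..1}" "y1 \<in> {0..1}" "y2 \<in> {0..1}" "x1 \<le> x2" "y1 \<le> y2"
  shows "C x1 y2 + C x2 y1 \<le> C x2 y2 + C x1 y1"
proof -
  have "C x2 y2 - C x1 y2 - C x2 y1 + C x1 y1 \<ge> 0"
    using assms unfolding copula_def by blast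
  then show ?thesis
    by linarith
qed

lemma copula_boundary:
  assumes "copula C" "x \<in> {0..1}"
  shows "C x 0 = 0" "C 0 x = 0" "C x 1 = x" "C 1 x = x"
  using assms unfolding copula_def by blast+

text \<open>The range condition is a consequence: the masses of [0,x] x [0,y] and of [0,x] x [y,1]
  give 0 <= \<open>C x y\<close> <= x.\<close>

lemma copulaI:
  assumes bd: "\<And>x. x \<in> {0..1} \<Longrightarrow> C x 0 = 0 \<and> C 0 x = 0 \<and> C x 1 = x \<and> C 1 x = x"
    and rect: "\<And>x1 x2 y1 y2. x1 \<in> {0..1} \<Longrightarrow> x2 \<in> {0..1} \<Longrightarrow> y1 \<in> {0..1} \<Longrightarrow> y2 \<in> {0..1} \<Longrightarrow>
      x1 \<le> x2 \<Longrightarrow> y1 \<le> y2 \<Longrightarrow> C x2 y2 - C x1 y2 - C x2 y1 + C x1 y1 \<ge> 0"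
  shows "copula C"
proof -
  have "C x y \<in> {0..1}" if "x \<in> {0..1}" "y \<in> {0..1}" for x y
    using rect[of 0 x 0 y] rect[of 0 x y 1] bd[of x] bd[of y] bd[of 0] bd[of 1] that by auto
  with bd rect show ?thesis
    unfolding copula_def by blast
qed

lemma copula_mono:
  assumes "copula C" "a \<in> {0..1}" "b \<in> {0..1}" "c \<in> {0..1}" "a \<le> b"
  shows "C a c \<le> C b c" "C c a \<le> C c b"
  using copula_rectangle[OF assms(1), of a b 0 c] copula_rectangle[OF assms(1), of 0 c a b]
    copula_boundary[OF assms(1)] assms by auto

text \<open>The rectangles [a,b] x [c,1] and [c,1] x [a,b] have nonnegative mass, and a full strip
  of width b - a has mass b - a.\<close>

lemma copula_lipschitz:
  assumes "copula C" "a \<in> {0..1}" "b \<in> {0..1}" "c \<in> {0..1}" "a \<le> b"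
  shows "C b c - C a c \<le> b - a" "C c b - C c a \<le> b - a"
  using copula_rectangle[OF assms(1), of a b c 1] copula_rectangle[OF assms(1), of c 1 a b]
    copula_boundary[OF assms(1)] assms by auto

text \<open>If \<open>C c c = c\<close>, all mass lies in [0,c] x [0,c] and [c,1] x [c,1]. Formally,
  \<open>C a b\<close> >= \<open>C a c\<close> >= c - (c - a) = a by the Lipschitz bound, and the
  other order of arguments is symmetric.\<close>

lemma copula_eq_of_fixed_point:
  assumes C: "copula C" and I: "a \<in> {0..1}" "b \<in> {0..1}" "c \<in> {0..1}"
    and ord: "a \<le> c" "c \<le> b" and eq: "C c c = c"
  shows "C a b = a" "C b a = a"
  using copula_mono[OF C I(3,2) I(1) ord(2)] copula_lipschitz[OF C I(1,3) I(3) ord(1)]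
    copula_mono[OF C I(2) _ I(1), of 1] copula_boundary[OF C I(1)] eq I by auto

section \<open>The copulas \<open>C\<^sub>\<psi>\<close>\<close>

text \<open>Each monotonicity condition is one bound on the increments of \<psi>; in this form they
  feed directly into linear arithmetic.\<close>

lemma eligible_iff:
  "\<psi> \<in> eligible \<delta> \<longleftrightarrow> \<psi> 0 = 0 \<and> (\<forall>a\<in>{0..1}. \<forall>b\<in>{0..1}. a \<le> b \<longrightarrow>
     0 \<le> \<psi> b - \<psi> a \<and> \<psi> b - \<psi> a \<le> b - a \<and>
     \<delta> b - \<delta> a - (b - a) \<le> \<psi> b - \<psi> a \<and> \<psi> b - \<psi> a \<le> \<delta> b - \<delta> a)"
  (is "?L \<longleftrightarrow> ?R")
proof
  assume L: ?L
  show ?R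
  proof (intro conjI ballI impI)
    show "\<psi> 0 = 0"
      using L by (simp add: eligible_def)
    fix a b :: real
    assume I: "a \<in> {0..1}" "b \<in> {0..1}" "a \<le> b"
    have mono: "mono_on {0..1} \<psi>" "mono_on {0..1} (\<lambda>x. x - \<psi> x)"
      "mono_on {0..1} (\<lambda>x. x - \<delta> x + \<psi> x)" "mono_on {0..1} (\<lambda>x. \<delta> x - \<psi> x)"
      using L by (simp_all add: eligible_def)
    show "0 \<le> \<psi> b - \<psi> a" "\<psi> b - \<psi> a \<le> b - a"
      "\<delta> b - \<delta> a - (b - a) \<le> \<psi> b - \<psi> a" "\<psi> b - \<psi> a \<le> \<delta> b - \<delta> a"
      using mono[THEN mono_onD, OF I] by linarith+
  qed
next
  assume R: ?R
  then have inc: "0 \<le> \<psi> b - \<psi> a \<and> \<psi> b - \<psi> a \<le> b - a \<and>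
      \<delta> b - \<delta> a - (b - a) \<le> \<psi> b - \<psi> a \<and> \<psi> b - \<psi> a \<le> \<delta> b - \<delta> a"
    if "a \<in> {0..1}" "b \<in> {0..1}" "a \<le> b" for a b
    using that by blast
  show ?L
    unfolding eligible_def
  proof (intro CollectI conjI mono_onI)
    show "\<psi> 0 = 0"
      using R by blast
    fix a b :: real
    assume I: "a \<in> {0..1}" "b \<in> {0..1}" "a \<le> b"
    show "\<psi> a \<le> \<psi> b" "a - \<psi> a \<le> b - \<psi> b" "a - \<delta> a + \<psi> a \<le> b - \<delta> b + \<psi> b" "\<delta> a - \<psi> a \<le> \<delta> b - \<psi> b"
      using inc[OF I] by linarith+
  qed
qed

lemma eligibleD:
  assumes "\<psi> \<in> eligible \<delta>" "a \<in> {0..1}" "b \<in> {0..1}" "a \<le> b"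
  shows "0 \<le> \<psi> b - \<psi> a" "\<psi> b - \<psi> a \<le> b - a"
    "\<delta> b - \<delta> a - (b - a) \<le> \<psi> b - \<psi> a" "\<psi> b - \<psi> a \<le> \<delta> b - \<delta> a"
  using assms unfolding eligible_iff by blast+

lemma diagonal_function_le: "diagonal_function \<delta> \<Longrightarrow> t \<in> {0..1} \<Longrightarrow> \<delta> t \<le> t"
  by (auto simp: diagonal_function_def)

lemma diagonal_function_0: "diagonal_function \<delta> \<Longrightarrow> \<delta> 0 = 0"
  unfolding diagonal_function_def by (metis atLeastAtMost_iff order.refl order_antisym zero_le_one)

lemma diagonal_function_1: "diagonal_function \<delta> \<Longrightarrow> \<delta> 1 = 1"
  by (simp add: diagonal_function_def)

lemma diagonal_function_continuous_on: "diagonal_function \<delta> \<Longrightarrow> continuous_on {0..1} \<delta>"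
  by (rule lipschitz_on_continuous_on[of 2])
    (auto simp: lipschitz_on_def diagonal_function_def dist_real_def)

text \<open>One of the two minima in \<open>C_psi\<close> is settled on each side of the diagonal;
  here b - \<psi> b >= a - \<psi> a >= \<delta> a - \<psi> a. What remains depends on \<psi> only
  through its increment over [a,b].\<close>

lemma C_psi_below_diagonal:
  assumes "diagonal_function \<delta>" "\<psi> \<in> eligible \<delta>" "a \<in> {0..1}" "b \<in> {0..1}" "a \<le> b"
  shows "C_psi \<delta> \<psi> b a = min a (\<delta> a + (\<psi> b - \<psi> a))"
  using eligibleD[OF assms(2-5)] diagonal_function_le[OF assms(1,3)]
  unfolding C_psi_def by linarith

lemma C_psi_above_diagonal:
  assumes "diagonal_function \<delta>" "\<psi> \<in> eligible \<delta>" "a \<in> {0..1}" "b \<in> {0..1}" "a \<le> b"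
  shows "C_psi \<delta> \<psi> a b = min a (\<delta> b - (\<psi> b - \<psi> a))"
  using eligibleD[OF assms(2-5)] diagonal_function_le[OF assms(1,4)]
  unfolding C_psi_def by linarith

lemma has_diagonal_section_C_psi:
  assumes "diagonal_function \<delta>" "\<psi> \<in> eligible \<delta>"
  shows "has_diagonal_section (C_psi \<delta> \<psi>) \<delta>"
  using C_psi_below_diagonal[OF assms] diagonal_function_le[OF assms(1)]
  by (auto simp: has_diagonal_section_def)

lemma min_rectangle:
  fixes s t u v :: real
  assumes "s \<le> t" "u \<le> v"
  shows "min t v - min s v - min t u + min s u \<ge> 0"
  using assms by linarith

text \<open>Both summands are minima of an increasing function of x and an increasing function of y,
  by the four eligibility conditions, so \<open>min_rectangle\<close> applies to each.\<close>

lemma copula_C_psi: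
  assumes \<delta>: "diagonal_function \<delta>" and \<psi>: "\<psi> \<in> eligible \<delta>"
  shows "copula (C_psi \<delta> \<psi>)"
proof (rule copulaI)
  fix x :: real assume x: "x \<in> {0..1}"
  have \<psi>0: "\<psi> 0 = 0"
    using \<psi> by (simp add: eligible_iff)
  show "C_psi \<delta> \<psi> x 0 = 0 \<and> C_psi \<delta> \<psi> 0 x = 0 \<and> C_psi \<delta> \<psi> x 1 = x \<and> C_psi \<delta> \<psi> 1 x = x"
    using C_psi_below_diagonal[OF \<delta> \<psi>, of 0 x] C_psi_above_diagonal[OF \<delta> \<psi>, of 0 x]
      C_psi_below_diagonal[OF \<delta> \<psi>, of x 1] C_psi_above_diagonal[OF \<delta> \<psi>, of x 1]
      eligibleD[OF \<psi>, of 0 x] eligibleD[OF \<psi>, of x 1]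
      diagonal_function_0[OF \<delta>] diagonal_function_1[OF \<delta>] \<psi>0 x by auto
next
  fix x1 x2 y1 y2 :: real
  assume x: "x1 \<in> {0..1}" "x2 \<in> {0..1}" "x1 \<le> x2" and y: "y1 \<in> {0..1}" "y2 \<in> {0..1}" "y1 \<le> y2"
  show "C_psi \<delta> \<psi> x2 y2 - C_psi \<delta> \<psi> x1 y2 - C_psi \<delta> \<psi> x2 y1 + C_psi \<delta> \<psi> x1 y1 \<ge> 0"
    using min_rectangle[of "\<psi> x1" "\<psi> x2" "y1 - \<delta> y1 + \<psi> y1" "y2 - \<delta> y2 + \<psi> y2"]
      min_rectangle[of "x1 - \<psi> x1" "x2 - \<psi> x2" "\<delta> y1 - \<psi> y1" "\<delta> y2 - \<psi> y2"]
      eligibleD[OF \<psi> x] eligibleD[OF \<psi> y]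
    unfolding C_psi_def by linarith
qed

section \<open>Domination of a copula by some \<open>C_psi\<close>\<close>

lemma copula_le_C_psi:
  assumes \<delta>: "diagonal_function \<delta>" and C: "copula C" and diag: "has_diagonal_section C \<delta>"
  obtains \<psi> where "\<psi> \<in> eligible \<delta>" "le_on_square C (C_psi \<delta> \<psi>)"
proof -
  have d: "C x x = \<delta> x" if "x \<in> {0..1}" for x
    using diag that by (simp add: has_diagonal_section_def)
  \<comment> \<open>The slacks in the subadditive, superadditive and comparison inequalities are the
    masses of [b,c] x [a,b], [a,b] x [b,c] and [a,b] x [a,b].\<close>
  have sub: "C c a - \<delta> a \<le> C b a - \<delta> a + (C c b - \<delta> b)"
    if "a \<in> {0..1}" "b \<in> {0..1}" "c \<in> {0..1}" "a \<le> b" "b \<le> c" for a b c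
    using copula_rectangle[OF C that(2,3,1,2)] d that by simp
  have "\<delta> b - C a b + (\<delta> c - C b c) \<le> \<delta> c - C a c"
    if "a \<in> {0..1}" "b \<in> {0..1}" "c \<in> {0..1}" "a \<le> b" "b \<le> c" for a b c
    using copula_rectangle[OF C that(1,2,2,3)] d that by simp
  then have super: "superadditive_on {0..1} (\<lambda>a b. \<delta> b - C a b)"
    unfolding superadditive_on_def by blast
  have le: "C b a - \<delta> a \<le> \<delta> b - C a b" if "a \<in> {0..1}" "b \<in> {0..1}" "a \<le> b" for a b
    using copula_rectangle[OF C that(1,2,1,2)] d that by simp
  have zero: "\<delta> a - C a a = 0" if "a \<in> {0..1}" for a
    using d that by simp
  have "\<exists>P. (\<forall>a\<in>{0..1}. \<forall>b\<in>{0..1}. a \<le> b \<longrightarrow> C b a - \<delta> a \<le> P a b \<and> P a b \<le> \<delta> b - C a b) \<and>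
    (\<forall>a\<in>{0..1}. \<forall>b\<in>{0..1}. \<forall>c\<in>{0..1}. a \<le> b \<longrightarrow> b \<le> c \<longrightarrow> P a c = P a b + P b c)"
    by (rule additive_between) (fact sub super le zero)+
  then obtain P where
    lower: "\<And>a b. a \<in> {0..1} \<Longrightarrow> b \<in> {0..1} \<Longrightarrow> a \<le> b \<Longrightarrow> C b a - \<delta> a \<le> P a b" and
    upper: "\<And>a b. a \<in> {0..1} \<Longrightarrow> b \<in> {0..1} \<Longrightarrow> a \<le> b \<Longrightarrow> P a b \<le> \<delta> b - C a b" and
    add: "\<And>a b c. a \<in> {0..1} \<Longrightarrow> b \<in> {0..1} \<Longrightarrow> c \<in> {0..1} \<Longrightarrow> a \<le> b \<Longrightarrow> b \<le> c
      \<Longrightarrow> P a c = P a b + P b c"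
    by blast
  \<comment> \<open>An additive interval function is the increment of its values on the intervals
    starting at 0.\<close>
  define \<psi> where "\<psi> x = P 0 x" for x
  have inc: "\<psi> b - \<psi> a = P a b" if "a \<in> {0..1}" "b \<in> {0..1}" "a \<le> b" for a b
    using add[of 0 a b] that by (simp add: \<psi>_def)
  \<comment> \<open>Monotonicity and the Lipschitz property of \<open>C\<close> show that the bounds
    on \<open>P\<close> are at least as strong as the four eligibility bounds.\<close>
  have elig: "\<psi> \<in> eligible \<delta>"
    unfolding eligible_iff
  proof (intro conjI ballI impI)
    show "\<psi> 0 = 0"
      using add[of 0 0 0] by (simp add: \<psi>_def)
    fix a b :: real
    assume I: "a \<in> {0..1}" "b \<in> {0..1}" and ord: "a \<le> b"
    note facts = inc[OF I ord] lower[OF I ord] upper[OF I ord] d[OF I(1)] d[OF I(2)]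
    show "0 \<le> \<psi> b - \<psi> a"
      using copula_mono(1)[OF C I I(1) ord] facts by linarith
    show "\<psi> b - \<psi> a \<le> b - a"
      using copula_lipschitz(1)[OF C I I(2) ord] facts by linarith
    show "\<delta> b - \<delta> a - (b - a) \<le> \<psi> b - \<psi> a"
      using copula_lipschitz(2)[OF C I I(2) ord] facts by linarith
    show "\<psi> b - \<psi> a \<le> \<delta> b - \<delta> a"
      using copula_mono(2)[OF C I I(1) ord] facts by linarith
  qed
  have "C x y \<le> C_psi \<delta> \<psi> x y" if I: "x \<in> {0..1}" "y \<in> {0..1}" for x y
  proof (cases "x \<le> y")
    case True
    then show ?thesis
      using C_psi_above_diagonal[OF \<delta> elig I True] copula_mono(2)[OF C I(2) _ I(1), of 1]
        copula_boundary[OF C I(1)] upper[OF I True] inc[OF I True] I by simp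
  next
    case False
    then have yx: "y \<le> x" by simp
    show ?thesis
      using C_psi_below_diagonal[OF \<delta> elig I(2,1) yx] copula_mono(1)[OF C I(1) _ I(2), of 1]
        copula_boundary[OF C I(2)] lower[OF I(2,1) yx] inc[OF I(2,1) yx] I by simp
  qed
  then show thesis
    using that elig by (auto simp: le_on_square_def)
qed

section \<open>Maximality of the copulas \<open>C_psi\<close>\<close>

text \<open>Near the diagonal and away from fixed points of \<delta>, the increment enters
  \<open>C_psi\<close> with a plus sign below the diagonal and a minus sign above it, so the
  pointwise order forces equal increments. Strictness matters: for \<delta> t = t every eligible
  \<psi> gives the same copula.\<close>

lemma eligible_increment_eq:
  assumes \<delta>: "diagonal_function \<delta>" and \<psi>: "\<psi> \<in> eligible \<delta>" and \<phi>: "\<phi> \<in> eligible \<delta>"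
    and le: "le_on_square (C_psi \<delta> \<psi>) (C_psi \<delta> \<phi>)"
    and I: "a \<in> {0..1}" "b \<in> {0..1}" and ord: "a \<le> b"
    and less: "\<And>t. a \<le> t \<Longrightarrow> t \<le> b \<Longrightarrow> \<delta> t < t"
  shows "\<psi> b - \<psi> a = \<phi> b - \<phi> a"
proof -
  have sub: "{a..b} \<subseteq> {0..1}"
    using I by auto
  have "continuous_on {a..b} (\<lambda>t. t - \<delta> t)"
    by (intro continuous_intros continuous_on_subset[OF diagonal_function_continuous_on[OF \<delta>] sub])
  then obtain m where "m \<in> {a..b}" and m: "\<And>t. t \<in> {a..b} \<Longrightarrow> m - \<delta> m \<le> t - \<delta> t"
    using continuous_attains_inf[of "{a..b}" "\<lambda>t. t - \<delta> t"] ord by auto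
  \<comment> \<open>The least gap t - \<delta> t on [a,b] serves as a uniform radius for local
    constancy.\<close>
  define \<epsilon> where "\<epsilon> = m - \<delta> m"
  have "\<epsilon> > 0"
    using less[of m] \<open>m \<in> {a..b}\<close> by (simp add: \<epsilon>_def)
  \<comment> \<open>Increments lie between 0 and t - s < \<epsilon>, so \<delta> s plus the
    increment, and \<delta> t minus it, are both below s: the minimum with s is inactive in both
    one-sided formulas.\<close>
  have close: "\<psi> t - \<psi> s = \<phi> t - \<phi> s" if st: "s \<in> {a..b}" "t \<in> {a..b}" "s \<le> t" "t - s < \<epsilon>" for s t
  proof -
    have J: "s \<in> {0..1}" "t \<in> {0..1}"
      using st sub by auto
    have "C_psi \<delta> \<psi> t s \<le> C_psi \<delta> \<phi> t s" "C_psi \<delta> \<psi> s t \<le> C_psi \<delta> \<phi> s t"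
      using le J by (auto simp: le_on_square_def)
    then show ?thesis
      using C_psi_below_diagonal[OF \<delta> \<psi> J st(3)] C_psi_above_diagonal[OF \<delta> \<psi> J st(3)]
        C_psi_below_diagonal[OF \<delta> \<phi> J st(3)] C_psi_above_diagonal[OF \<delta> \<phi> J st(3)]
        eligibleD[OF \<psi> J st(3)] eligibleD[OF \<phi> J st(3)] m[OF st(1)] m[OF st(2)] st(4)
      unfolding \<epsilon>_def by linarith
  qed
  have "\<psi> a - \<phi> a = \<psi> b - \<phi> b"
  proof (rule connected_local_const[where A = "{a..b}" and f = "\<lambda>t. \<psi> t - \<phi> t"])
    show "\<forall>s\<in>{a..b}. eventually (\<lambda>t. \<psi> s - \<phi> s = \<psi> t - \<phi> t) (at s within {a..b})"
    proof
      fix s assume s: "s \<in> {a..b}"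
      have "\<psi> s - \<phi> s = \<psi> t - \<phi> t" if t: "t \<in> {a..b}" "dist t s < \<epsilon>" for t
        using close[of s t] close[of t s] s t by (cases "s \<le> t") (auto simp: dist_real_def)
      then show "eventually (\<lambda>t. \<psi> s - \<phi> s = \<psi> t - \<phi> t) (at s within {a..b})"
        using \<open>\<epsilon> > 0\<close> by (auto simp: eventually_at intro!: exI[of _ \<epsilon>])
    qed
  qed (use ord in auto)
  then show ?thesis
    by simp
qed

text \<open>Bounding \<open>C\<close> above by some \<open>C_psi \<delta> \<phi>\<close> reduces the
  comparison with an arbitrary copula to one between two eligible functions.\<close>

lemma eq_on_square_of_C_psi_le:
  assumes \<delta>: "diagonal_function \<delta>" and \<psi>: "\<psi> \<in> eligible \<delta>"
    and C: "copula C" and diag: "has_diagonal_section C \<delta>" and le: "le_on_square (C_psi \<delta> \<psi>) C"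
  shows "eq_on_square C (C_psi \<delta> \<psi>)"
proof -
  obtain \<phi> where \<phi>: "\<phi> \<in> eligible \<delta>" and le': "le_on_square C (C_psi \<delta> \<phi>)"
    using copula_le_C_psi[OF \<delta> C diag] .
  have le'': "le_on_square (C_psi \<delta> \<psi>) (C_psi \<delta> \<phi>)"
    using le le' unfolding le_on_square_def by (meson order_trans)
  have sandwich: "C x y = C_psi \<delta> \<psi> x y"
    if "C_psi \<delta> \<psi> x y = C_psi \<delta> \<phi> x y" "x \<in> {0..1}" "y \<in> {0..1}" for x y
    using le le' that unfolding le_on_square_def by (metis order_antisym)
  have eq: "C a b = C_psi \<delta> \<psi> a b \<and> C b a = C_psi \<delta> \<psi> b a"
    if I: "a \<in> {0..1}" "b \<in> {0..1}" and ord: "a \<le> b" for a b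
  \<comment> \<open>Across a fixed point \<psi> and \<phi> may have different increments, but there
    the value a is forced on both copulas.\<close>
  proof (cases "\<exists>c. a \<le> c \<and> c \<le> b \<and> \<delta> c = c")
    case True
    then obtain c where c: "a \<le> c" "c \<le> b" "\<delta> c = c" by blast
    then have "c \<in> {0..1}" using I by auto
    with c diag has_diagonal_section_C_psi[OF \<delta> \<psi>] have "C c c = c" "C_psi \<delta> \<psi> c c = c"
      by (auto simp: has_diagonal_section_def)
    then show ?thesis
      using copula_eq_of_fixed_point[OF C I \<open>c \<in> {0..1}\<close> c(1,2)]
        copula_eq_of_fixed_point[OF copula_C_psi[OF \<delta> \<psi>] I \<open>c \<in> {0..1}\<close> c(1,2)] by simp
  next
    case False
    have "\<delta> t < t" if "a \<le> t" "t \<le> b" for t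
      using diagonal_function_le[OF \<delta>, of t] False that I by fastforce
    then have "\<psi> b - \<psi> a = \<phi> b - \<phi> a"
      by (rule eligible_increment_eq[OF \<delta> \<psi> \<phi> le'' I ord])
    then have "C_psi \<delta> \<psi> a b = C_psi \<delta> \<phi> a b" "C_psi \<delta> \<psi> b a = C_psi \<delta> \<phi> b a"
      using C_psi_below_diagonal[OF \<delta> \<psi> I ord] C_psi_above_diagonal[OF \<delta> \<psi> I ord]
        C_psi_below_diagonal[OF \<delta> \<phi> I ord] C_psi_above_diagonal[OF \<delta> \<phi> I ord] by simp_all
    then show ?thesis
      using sandwich[of a b] sandwich[of b a] I by simp
  qed
  show ?thesis
    unfolding eq_on_square_def by (metis eq linear)
qed

theorem corollary5p7:
  fixes \<delta> :: "real \<Rightarrow> real" and C :: "real \<Rightarrow> real \<Rightarrow> real"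
  assumes "diagonal_function \<delta>"
    and "copula C"
    and "has_diagonal_section C \<delta>"
  shows "undominated \<delta> C \<longleftrightarrow> (\<exists>\<psi>\<in>eligible \<delta>. eq_on_square C (C_psi \<delta> \<psi>))"
proof
  assume und: "undominated \<delta> C"
  obtain \<psi> where \<psi>: "\<psi> \<in> eligible \<delta>" and le: "le_on_square C (C_psi \<delta> \<psi>)"
    using copula_le_C_psi[OF assms] .
  \<comment> \<open>The dominating \<open>C_psi\<close> is itself an admissible competitor, so it
    cannot differ from \<open>C\<close>.\<close>
  have "eq_on_square (C_psi \<delta> \<psi>) C"
    using und copula_C_psi[OF assms(1) \<psi>] has_diagonal_section_C_psi[OF assms(1) \<psi>] le
    unfolding undominated_def by blast
  then have "eq_on_square C (C_psi \<delta> \<psi>)"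
    by (simp add: eq_on_square_def)
  with \<psi> show "\<exists>\<psi>\<in>eligible \<delta>. eq_on_square C (C_psi \<delta> \<psi>)"
    by blast
next
  assume "\<exists>\<psi>\<in>eligible \<delta>. eq_on_square C (C_psi \<delta> \<psi>)"
  then obtain \<psi> where \<psi>: "\<psi> \<in> eligible \<delta>" and eq: "eq_on_square C (C_psi \<delta> \<psi>)"
    by blast
  show "undominated \<delta> C"
    unfolding undominated_def
  proof (intro notI, elim exE conjE)
    fix C' assume C': "copula C'" "has_diagonal_section C' \<delta>" "\<not> eq_on_square C' C" "le_on_square C C'"
    then have "le_on_square (C_psi \<delta> \<psi>) C'"
      using eq by (simp add: le_on_square_def eq_on_square_def)
    from eq_on_square_of_C_psi_le[OF assms(1) \<psi> C'(1,2) this] show False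
      using C'(3) eq by (simp add: eq_on_square_def)
  qed
qed

end
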